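(* Let $\mathcal{I}$ be an indexing set and let $\mathsf{B}$ be a pointed building set on $\mathcal{I}$. Then the poset $(\mathcal{O}(\mathsf{B}), \preceq)$ of ornamentations of $\mathsf{B}$ is a complete lattice.
   Context: Let $\mathcal{I}$ be a set. A pointed subset $(S,i)$ of $\mathcal{I}$ is a pair with $S \subseteq \mathcal{I}$ and $i \in S$; it is said to be pointed at $i$. A pointed set is often identified with its underlying set, so $j\in(S,i)$ means $j\in S$, and $(S,i)\subseteq(T,j)$ means $S\subseteq T$. For a collection $\mathcal{C}$ of pointed subsets, $\mathcal{C}|_i := \{(S,j)\in\mathcal{C} \mid j=i\}$. A pointed building set $\mathsf{B}$ on $\mathcal{I}$ is a collection of pointed subsets of $\mathcal{I}$ such that: (1) $(\{i\},i)\in\mathsf{B}$ for all $i\in\mathcal{I}$; (2) for all $(S,i),(T,j)\in\mathsf{B}$, if $j\in S$ then $(S\cup T,i)\in\mathsf{B}$; (3) for every $i\in\mathcal{I}$, $\mathsf{B}|_i$ is closed under arbitrary non-empty unions. An ornamentation of $\mathsf{B}$ is a function $\rho:\mathcal{I}\to\mathsf{B}$ such that (1) $\rho(i)\in\mathsf{B}|_i$ for all $i\in\mathcal{I}$; (2) for all $i,j\in\mathcal{I}$, if $j\in\rho(i)$ then $\rho(j)\subseteq\rho(i)$. The set of ornamentations is $\mathcal{O}(\mathsf{B})$, partially ordered by $\rho_1\preceq\rho_2$ iff $\rho_1(i)\subseteq\rho_2(i)$ for all $i\in\mathcal{I}$. A lattice is complete if every subset has a least upper bound and a greatest lower bound.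 *)

theory Defs
  imports "HOL-Algebra.Complete_Lattice" "HOL-Library.FuncSet"
begin

text \<open>A pointed set \<open>(S, i)\<close> is an ordinary pair; its underlying set is \<open>fst\<close> and its
  base point is \<open>snd\<close>.\<close>

type_synonym 'a pointed_set = "'a set \<times> 'a"

definition pointed_subsets :: "'a set \<Rightarrow> 'a pointed_set set" where
  "pointed_subsets I = {(S, i). S \<subseteq> I \<and> i \<in> S}"

definition pointed_at :: "'a pointed_set set \<Rightarrow> 'a \<Rightarrow> 'a pointed_set set" where
  "pointed_at C i = {P \<in> C. snd P = i}"

definition pointed_building_set :: "'a set \<Rightarrow> 'a pointed_set set \<Rightarrow> bool" where
  "pointed_building_set I B \<longleftrightarrow>
     B \<subseteq> pointed_subsets I \<and>
     (\<forall>i\<in>I. ({i}, i) \<in> B) \<and>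
     (\<forall>S i T j. (S, i) \<in> B \<longrightarrow> (T, j) \<in> B \<longrightarrow> j \<in> S \<longrightarrow> (S \<union> T, i) \<in> B) \<and>
     (\<forall>i\<in>I. \<forall>X. X \<subseteq> pointed_at B i \<longrightarrow> X \<noteq> {} \<longrightarrow> (\<Union>P\<in>X. fst P, i) \<in> pointed_at B i)"

text \<open>Functions on \<open>I\<close> are taken extensional (\<open>undefined\<close> outside \<open>I\<close>), so that two
  ornamentations are equal as soon as they agree on \<open>I\<close>.\<close>

definition ornamentations :: "'a set \<Rightarrow> 'a pointed_set set \<Rightarrow> ('a \<Rightarrow> 'a pointed_set) set" where
  "ornamentations I B =
     {\<rho> \<in> I \<rightarrow>\<^sub>E B.
        (\<forall>i\<in>I. \<rho> i \<in> pointed_at B i) \<and>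
        (\<forall>i\<in>I. \<forall>j\<in>I. j \<in> fst (\<rho> i) \<longrightarrow> fst (\<rho> j) \<subseteq> fst (\<rho> i))}"

definition ornamentation_poset ::
    "'a set \<Rightarrow> 'a pointed_set set \<Rightarrow> ('a \<Rightarrow> 'a pointed_set) gorder" where
  "ornamentation_poset I B =
     \<lparr>carrier = ornamentations I B,
      eq = (=),
      le = (\<lambda>\<rho>\<^sub>1 \<rho>\<^sub>2. \<forall>i\<in>I. fst (\<rho>\<^sub>1 i) \<subseteq> fst (\<rho>\<^sub>2 i))\<rparr>"

end

theory Submission
  imports Defs
begin

text \<open>
  It suffices to construct all meets, the empty one included: the join of a set of ornamentations
  is then the meet of its upper bounds. The pointwise intersection of ornamentations need not take
  values in \<open>B\<close>. But since \<open>B\<close> restricted to a base point \<open>i\<close> is closed under non-empty unions,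
  every set \<open>T\<close> containing \<open>i\<close> has a largest subset belonging to \<open>B\<close> with base point \<open>i\<close>, here called the
  core of \<open>T\<close> at \<open>i\<close>. The meet is obtained by replacing each pointwise intersection by its core.
  It is the largest candidate by maximality of the core, and the only point at issue is that it is
  an ornamentation. If \<open>j\<close> lies in the core at \<open>i\<close>, then the core at \<open>j\<close> may be merged into the core
  at \<open>i\<close> by the second building-set axiom; the result is still contained in all the given
  ornaments at \<open>i\<close>, because each given ornament at \<open>j\<close> is nested in the one at \<open>i\<close>. By maximality
  the merged set is the core at \<open>i\<close> itself (lemma \<open>core_nested\<close>).
\<close>

definition core :: "'a pointed_set set \<Rightarrow> 'a set \<Rightarrow> 'a \<Rightarrow> 'a set" where
  "core B T i = \<Union>{S. (S, i) \<in> B \<and> S \<subseteq> T}"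

lemma core_subset: "core B T i \<subseteq> T"
  by (auto simp: core_def)

lemma core_greatest: "(S, i) \<in> B \<Longrightarrow> S \<subseteq> T \<Longrightarrow> S \<subseteq> core B T i"
  by (auto simp: core_def)

text \<open>The singleton at \<open>i\<close> makes the union defining the core non-empty, so that the union axiom
  applies.\<close>

lemma core_mem:
  assumes B: "pointed_building_set I B" and i: "i \<in> I" "i \<in> T"
  shows "(core B T i, i) \<in> B"
proof -
  let ?X = "{P \<in> pointed_at B i. fst P \<subseteq> T}"
  have "({i}, i) \<in> B"
    using B i(1) by (simp add: pointed_building_set_def)
  then have "?X \<noteq> {}"
    using i(2) by (force simp: pointed_at_def)
  moreover have "?X \<subseteq> pointed_at B i"
    by blast
  ultimately have "(\<Union>P\<in>?X. fst P, i) \<in> pointed_at B i"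
    using B i(1) unfolding pointed_building_set_def by blast
  moreover have "(\<Union>P\<in>?X. fst P) = core B T i"
    by (force simp: core_def pointed_at_def)
  ultimately show ?thesis
    by (simp add: pointed_at_def)
qed

lemma core_nested:
  assumes B: "pointed_building_set I B"
    and I: "i \<in> I" "j \<in> I" and T: "i \<in> T" "j \<in> U" "U \<subseteq> T"
    and j: "j \<in> core B T i"
  shows "core B U j \<subseteq> core B T i"
proof -
  have "(core B T i, i) \<in> B" "(core B U j, j) \<in> B"
    using core_mem[OF B] I T by blast+
  then have "(core B T i \<union> core B U j, i) \<in> B"
    using B j unfolding pointed_building_set_def by blast
  moreover have "core B T i \<union> core B U j \<subseteq> T"
    using core_subset[of B T i] core_subset[of B U j] T(3) by blast
  ultimately have "core B T i \<union> core B U j \<subseteq> core B T i"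
    by (rule core_greatest)
  then show ?thesis
    by simp
qed

lemma ornamentation_at:
  assumes "\<rho> \<in> ornamentations I B" "i \<in> I"
  shows "snd (\<rho> i) = i" "(fst (\<rho> i), i) \<in> B"
proof -
  show base: "snd (\<rho> i) = i"
    using assms by (simp add: ornamentations_def pointed_at_def)
  have "\<rho> i \<in> B"
    using assms by (simp add: ornamentations_def pointed_at_def)
  then show "(fst (\<rho> i), i) \<in> B"
    using base by (metis prod.collapse)
qed

lemma ornamentation_base_mem:
  assumes "pointed_building_set I B" "\<rho> \<in> ornamentations I B" "i \<in> I"
  shows "i \<in> fst (\<rho> i)"
proof -
  have "B \<subseteq> pointed_subsets I"
    using assms(1) unfolding pointed_building_set_def by blast
  then show ?thesis
    using ornamentation_at(2)[OF assms(2,3)] by (auto simp: pointed_subsets_def)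
qed

lemma ornamentation_nested:
  assumes "\<rho> \<in> ornamentations I B" "i \<in> I" "j \<in> I" "j \<in> fst (\<rho> i)"
  shows "fst (\<rho> j) \<subseteq> fst (\<rho> i)"
  using assms unfolding ornamentations_def by blast

text \<open>Restricting to \<open>I\<close> makes the meet extensional. For empty \<open>A\<close> the intersection is the whole
  type, and the value at \<open>i\<close> is the largest member of \<open>B\<close> pointed at \<open>i\<close>: this is the top element.\<close>

definition ornamentation_meet ::
    "'a set \<Rightarrow> 'a pointed_set set \<Rightarrow> ('a \<Rightarrow> 'a pointed_set) set \<Rightarrow> 'a \<Rightarrow> 'a pointed_set" where
  "ornamentation_meet I B A = (\<lambda>i\<in>I. (core B (\<Inter>\<rho>\<in>A. fst (\<rho> i)) i, i))"

lemma ornamentation_meet_mem: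
  assumes B: "pointed_building_set I B" and A: "A \<subseteq> ornamentations I B"
  shows "ornamentation_meet I B A \<in> ornamentations I B"
proof -
  let ?T = "\<lambda>i. \<Inter>\<rho>\<in>A. fst (\<rho> i)"
  have base: "i \<in> ?T i" if "i \<in> I" for i
    using ornamentation_base_mem[OF B _ that] A by blast
  have mem: "(core B (?T i) i, i) \<in> B" if "i \<in> I" for i
    using core_mem[OF B that base[OF that]] .
  have nested: "core B (?T j) j \<subseteq> core B (?T i) i"
    if "i \<in> I" "j \<in> I" "j \<in> core B (?T i) i" for i j
  proof (rule core_nested[OF B that(1,2) base base _ that(3)])
    have "j \<in> ?T i"
      using that(3) core_subset[of B "?T i" i] by blast
    then show "?T j \<subseteq> ?T i"
      using ornamentation_nested[OF _ that(1,2)] A by blast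
  qed (use that in auto)
  show ?thesis
    unfolding ornamentations_def ornamentation_meet_def pointed_at_def
  proof (intro CollectI conjI ballI impI)
    show "(\<lambda>i\<in>I. (core B (?T i) i, i)) \<in> I \<rightarrow>\<^sub>E B"
      using mem by simp
  qed (use mem nested in simp_all)
qed

text \<open>Base points agree automatically and extensionality makes the values outside \<open>I\<close>
  irrelevant, so only the underlying sets have to be compared.\<close>

lemma ornamentation_antisym:
  assumes orn: "\<rho> \<in> ornamentations I B" "\<sigma> \<in> ornamentations I B"
    and le: "\<And>i. i \<in> I \<Longrightarrow> fst (\<rho> i) \<subseteq> fst (\<sigma> i)" "\<And>i. i \<in> I \<Longrightarrow> fst (\<sigma> i) \<subseteq> fst (\<rho> i)"
  shows "\<rho> = \<sigma>"
proof (rule extensionalityI[of _ I])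
  show "\<rho> i = \<sigma> i" if "i \<in> I" for i
  proof (rule prod_eqI)
    show "fst (\<rho> i) = fst (\<sigma> i)"
      using le[OF that] by (rule equalityI)
    show "snd (\<rho> i) = snd (\<sigma> i)"
      using orn that by (simp add: ornamentation_at(1))
  qed
  show "\<rho> \<in> extensional I" "\<sigma> \<in> extensional I"
    using orn by (simp_all add: ornamentations_def PiE_def)
qed

lemma ornamentation_poset_partial_order: "partial_order (ornamentation_poset I B)"
proof unfold_locales
  fix \<rho> \<sigma>
  assume "\<rho> \<sqsubseteq>\<^bsub>ornamentation_poset I B\<^esub> \<sigma>" "\<sigma> \<sqsubseteq>\<^bsub>ornamentation_poset I B\<^esub> \<rho>"
    "\<rho> \<in> carrier (ornamentation_poset I B)" "\<sigma> \<in> carrier (ornamentation_poset I B)"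
  then show "\<rho> .=\<^bsub>ornamentation_poset I B\<^esub> \<sigma>"
    by (simp add: ornamentation_poset_def ornamentation_antisym)
next
  fix \<rho> \<sigma> \<tau>
  assume "\<rho> \<sqsubseteq>\<^bsub>ornamentation_poset I B\<^esub> \<sigma>" "\<sigma> \<sqsubseteq>\<^bsub>ornamentation_poset I B\<^esub> \<tau>"
  then show "\<rho> \<sqsubseteq>\<^bsub>ornamentation_poset I B\<^esub> \<tau>"
    unfolding ornamentation_poset_def gorder.simps by (meson order_trans)
qed (simp_all add: ornamentation_poset_def)

lemma ornamentation_meet_greatest:
  assumes B: "pointed_building_set I B" and A: "A \<subseteq> ornamentations I B"
  shows "greatest (ornamentation_poset I B) (ornamentation_meet I B A)
           (Lower (ornamentation_poset I B) A)"
proof (rule greatest_LowerI)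
  show "A \<subseteq> carrier (ornamentation_poset I B)"
    using A by (simp add: ornamentation_poset_def)
  show "ornamentation_meet I B A \<in> carrier (ornamentation_poset I B)"
    using ornamentation_meet_mem[OF B A] by (simp add: ornamentation_poset_def)
next
  fix \<rho> assume "\<rho> \<in> A"
  then show "ornamentation_meet I B A \<sqsubseteq>\<^bsub>ornamentation_poset I B\<^esub> \<rho>"
    using core_subset[of B "\<Inter>\<rho>\<in>A. fst (\<rho> i)" i for i]
    by (simp add: ornamentation_poset_def ornamentation_meet_def) blast
next
  fix \<sigma> assume "\<sigma> \<in> Lower (ornamentation_poset I B) A"
  then have \<sigma>: "\<sigma> \<in> ornamentations I B"
    and below: "\<And>\<rho> i. \<rho> \<in> A \<Longrightarrow> i \<in> I \<Longrightarrow> fst (\<sigma> i) \<subseteq> fst (\<rho> i)"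
    using A by (auto simp: Lower_def ornamentation_poset_def)
  have "fst (\<sigma> i) \<subseteq> core B (\<Inter>\<rho>\<in>A. fst (\<rho> i)) i" if "i \<in> I" for i
    by (intro core_greatest[OF ornamentation_at(2)[OF \<sigma> that]] INT_greatest below[OF _ that])
  then show "\<sigma> \<sqsubseteq>\<^bsub>ornamentation_poset I B\<^esub> ornamentation_meet I B A"
    by (simp add: ornamentation_poset_def ornamentation_meet_def)
qed

theorem theorem1p4:
  fixes I :: "'a set" and B :: "'a pointed_set set"
  assumes "pointed_building_set I B"
  shows "complete_lattice (ornamentation_poset I B)"
proof (rule partial_order.complete_lattice_criterion1[OF ornamentation_poset_partial_order])
  let ?L = "ornamentation_poset I B"
  have "Lower ?L {} = carrier ?L"
    by (simp add: Lower_def)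
  then show "\<exists>g. greatest ?L g (carrier ?L)"
    using ornamentation_meet_greatest[OF assms, of "{}"] by auto
  show "\<exists>g. greatest ?L g (Lower ?L A)" if "A \<subseteq> carrier ?L" for A
    using ornamentation_meet_greatest[OF assms, of A] that
    by (auto simp: ornamentation_poset_def)
qed

end
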